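(* There exists a matching market with resource-regional caps in which no matching is both direct-envy stable and envy-free.
   Context: A matching market with resource-regional caps consists of: finite sets $\mathcal{S}$ (students), $\mathcal{C}$ (colleges), $\mathcal{R}$ (non-empty resources), and an additional empty resource $r_0$, with $\mathcal{R}_0=\mathcal{R}\cup\{r_0\}$; a quota $q_c>0$ for each $c\in\mathcal{C}$; for each $r\in\mathcal{R}$ a non-empty region $C_r\subseteq\mathcal{C}$ (regions may overlap) and a cap $q_r>0$; by convention $C_{r_0}=\mathcal{C}$ and $q_{r_0}=|\mathcal{S}|$; for each college $c$ a strict ranking $\succ_c$ of $\mathcal{S}$; for each student $s$ a strict ranking $\succ_s$ of $(\mathcal{C}\times\mathcal{R}_0)\cup\{\emptyset\}$. A pair $(c,r)$ is acceptable for $s$ if $(c,r)\succ_s\emptyset$. It is assumed that whenever $r\in\mathcal{R}$ and $(c,r)$ is acceptable for $s$, $(c,r)\succ_s(c,r_0)$. The set of contracts is $\mathcal{X}=\mathcal{S}\times\mathcal{C}\times\mathcal{R}_0$. A matching $\mu$ is a subset of $\mathcal{X}$ in which each student appears in at most one contract; $\mu_s$ denotes the contract of $s$ in $\mu$ (also identified with its college-resource pair), with $\mu_s=\emptyset$ if $s$ is unmatched (and then $\mu\setminus\{\mu_s\}=\mu$). $\mu$ is feasible if each college $c$ is in at most $q_c$ contracts of $\mu$, and for each $r\in\mathcal{R}$ at most $q_r$ contracts of $\mu$ contain $r$, all of them with colleges in $C_r$. $\mu$ is individually rational if $(c,r)\succ_s\emptyset$ for each $(s,c,r)\in\mu$.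 Let $\mu$ be feasible and individually rational. - $(s,c,r)\in\mathcal{X}\setminus\mu$ envy-blocks $\mu$ through $(s',c,r')\in\mu$ if $(c,r)\succ_s\mu_s$, $s\succ_c s'$, and $(\mu\setminus\{\mu_s,(s',c,r')\})\cup\{(s,c,r)\}$ is feasible. $\mu$ is envy-free if it has no envy-blocking contracts. The contract $(s,c,r)$ direct-envy-blocks $\mu$ if it envy-blocks $\mu$ through some $(s',c,r')\in\mu$ with $r\in\{r',r_0\}$. - $(s,c,r)\in\mathcal{X}\setminus\mu$ waste-blocks $\mu$ if $(c,r)\succ_s\mu_s$ and $(\mu\setminus\{\mu_s\})\cup\{(s,c,r)\}$ is feasible. - A waste-blocking contract $(s,c,r)$ is dominated if there is a contract $(s',c,r')\in\mathcal{X}\setminus\mu$ (same college $c$) that is neither waste-blocking nor direct-envy-blocking under $\mu$, but is direct-envy-blocking under $(\mu\setminus\{\mu_s\})\cup\{(s,c,r)\}$. A feasible individually rational matching is direct-envy stable if it has no direct-envy-blocking contracts and every waste-blocking contract is dominated. *)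

theory Defs
  imports Main
begin

text \<open>Strict rankings are relations: a pair \<open>(x, y)\<close> belongs to the ranking when \<open>x\<close> is strictly
  preferred to \<open>y\<close>. In student rankings \<open>Some (c, r)\<close> is a college-resource pair and \<open>None\<close> is
  the outside option. The field \<open>empty_res\<close> is the empty resource; \<open>region\<close> and \<open>cap\<close> take it
  as an argument too, with values fixed by convention in \<open>valid_market\<close>.\<close>

record ('s, 'c, 'r) market =
  students :: "'s set"
  colleges :: "'c set"
  resources :: "'r set"
  empty_res :: 'r
  quota :: "'c \<Rightarrow> nat"
  region :: "'r \<Rightarrow> 'c set"
  cap :: "'r \<Rightarrow> nat"
  col_pref :: "'c \<Rightarrow> 's rel"
  stud_pref :: "'s \<Rightarrow> ('c \<times> 'r) option rel"

definition resources0 :: "('s, 'c, 'r) market \<Rightarrow> 'r set" where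
  "resources0 M = insert (empty_res M) (resources M)"

definition strict_ranking :: "'a set \<Rightarrow> 'a rel \<Rightarrow> bool" where
  "strict_ranking A P \<longleftrightarrow> P \<subseteq> A \<times> A \<and> strict_linear_order_on A P"

definition cprefers :: "('s, 'c, 'r) market \<Rightarrow> 'c \<Rightarrow> 's \<Rightarrow> 's \<Rightarrow> bool" where
  "cprefers M c s s' \<longleftrightarrow> (s, s') \<in> col_pref M c"

definition sprefers ::
    "('s, 'c, 'r) market \<Rightarrow> 's \<Rightarrow> ('c \<times> 'r) option \<Rightarrow> ('c \<times> 'r) option \<Rightarrow> bool" where
  "sprefers M s x y \<longleftrightarrow> (x, y) \<in> stud_pref M s"

definition acceptable :: "('s, 'c, 'r) market \<Rightarrow> 's \<Rightarrow> 'c \<times> 'r \<Rightarrow> bool" where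
  "acceptable M s x \<longleftrightarrow> sprefers M s (Some x) None"

definition valid_market :: "('s, 'c, 'r) market \<Rightarrow> bool" where
  "valid_market M \<longleftrightarrow>
     finite (students M) \<and> finite (colleges M) \<and> finite (resources M) \<and>
     empty_res M \<notin> resources M \<and>
     (\<forall>c\<in>colleges M. quota M c > 0) \<and>
     (\<forall>r\<in>resources M. region M r \<noteq> {} \<and> region M r \<subseteq> colleges M \<and> cap M r > 0) \<and>
     region M (empty_res M) = colleges M \<and> cap M (empty_res M) = card (students M) \<and>
     (\<forall>c\<in>colleges M. strict_ranking (students M) (col_pref M c)) \<and>
     (\<forall>s\<in>students M.
        strict_ranking (insert None (Some ` (colleges M \<times> resources0 M))) (stud_pref M s)) \<and>
     (\<forall>s\<in>students M. \<forall>c\<in>colleges M. \<forall>r\<in>resources M.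
        acceptable M s (c, r) \<longrightarrow> sprefers M s (Some (c, r)) (Some (c, empty_res M)))"

type_synonym ('s, 'c, 'r) contract = "'s \<times> 'c \<times> 'r"

definition contracts :: "('s, 'c, 'r) market \<Rightarrow> ('s, 'c, 'r) contract set" where
  "contracts M = students M \<times> colleges M \<times> resources0 M"

definition matching :: "('s, 'c, 'r) market \<Rightarrow> ('s, 'c, 'r) contract set \<Rightarrow> bool" where
  "matching M \<mu> \<longleftrightarrow> \<mu> \<subseteq> contracts M \<and> (\<forall>s x y. (s, x) \<in> \<mu> \<longrightarrow> (s, y) \<in> \<mu> \<longrightarrow> x = y)"

text \<open>\<open>assigned \<mu> s\<close> and \<open>contract_of \<mu> s\<close> both render \<open>\<mu>\<^sub>s\<close>: the former as an option in the
  ranking of \<open>s\<close>, the latter as a set of contracts (a singleton, or empty if \<open>s\<close> is unmatched),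
  so that \<open>\<mu> - contract_of \<mu> s\<close> is \<open>\<mu>\<close> without the contract of \<open>s\<close>.\<close>

definition assigned :: "('s, 'c, 'r) contract set \<Rightarrow> 's \<Rightarrow> ('c \<times> 'r) option" where
  "assigned \<mu> s = (if \<exists>x. (s, x) \<in> \<mu> then Some (THE x. (s, x) \<in> \<mu>) else None)"

definition contract_of :: "('s, 'c, 'r) contract set \<Rightarrow> 's \<Rightarrow> ('s, 'c, 'r) contract set" where
  "contract_of \<mu> s = {(s', x) \<in> \<mu>. s' = s}"

definition feasible :: "('s, 'c, 'r) market \<Rightarrow> ('s, 'c, 'r) contract set \<Rightarrow> bool" where
  "feasible M \<mu> \<longleftrightarrow> matching M \<mu> \<and>
     (\<forall>c\<in>colleges M. card {(s, c', r) \<in> \<mu>. c' = c} \<le> quota M c) \<and>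
     (\<forall>r\<in>resources M. card {(s, c, r') \<in> \<mu>. r' = r} \<le> cap M r \<and>
        (\<forall>s c. (s, c, r) \<in> \<mu> \<longrightarrow> c \<in> region M r))"

definition individually_rational ::
    "('s, 'c, 'r) market \<Rightarrow> ('s, 'c, 'r) contract set \<Rightarrow> bool" where
  "individually_rational M \<mu> \<longleftrightarrow> (\<forall>(s, c, r)\<in>\<mu>. acceptable M s (c, r))"

text \<open>The blocking notions are meant for feasible individually rational \<open>\<mu>\<close>. In \<open>dominated\<close>
  they are also applied to the matching obtained by adding a waste-blocking contract, which is
  again feasible and individually rational.\<close>

definition envy_blocks_through :: "('s, 'c, 'r) market \<Rightarrow> ('s, 'c, 'r) contract set \<Rightarrow>
    ('s, 'c, 'r) contract \<Rightarrow> ('s, 'c, 'r) contract \<Rightarrow> bool" where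
  "envy_blocks_through M \<mu> = (\<lambda>(s, c, r) (s', c', r').
     (s, c, r) \<in> contracts M - \<mu> \<and> (s', c', r') \<in> \<mu> \<and> c' = c \<and>
     sprefers M s (Some (c, r)) (assigned \<mu> s) \<and> cprefers M c s s' \<and>
     feasible M ((\<mu> - (contract_of \<mu> s \<union> {(s', c', r')})) \<union> {(s, c, r)}))"

definition envy_blocks :: "('s, 'c, 'r) market \<Rightarrow> ('s, 'c, 'r) contract set \<Rightarrow>
    ('s, 'c, 'r) contract \<Rightarrow> bool" where
  "envy_blocks M \<mu> x \<longleftrightarrow> (\<exists>y\<in>\<mu>. envy_blocks_through M \<mu> x y)"

definition envy_free :: "('s, 'c, 'r) market \<Rightarrow> ('s, 'c, 'r) contract set \<Rightarrow> bool" where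
  "envy_free M \<mu> \<longleftrightarrow>
     feasible M \<mu> \<and> individually_rational M \<mu> \<and> (\<nexists>x. envy_blocks M \<mu> x)"

definition direct_envy_blocks :: "('s, 'c, 'r) market \<Rightarrow> ('s, 'c, 'r) contract set \<Rightarrow>
    ('s, 'c, 'r) contract \<Rightarrow> bool" where
  "direct_envy_blocks M \<mu> = (\<lambda>(s, c, r).
     \<exists>s' r'. (s', c, r') \<in> \<mu> \<and> envy_blocks_through M \<mu> (s, c, r) (s', c, r') \<and>
       r \<in> {r', empty_res M})"

definition waste_blocks :: "('s, 'c, 'r) market \<Rightarrow> ('s, 'c, 'r) contract set \<Rightarrow>
    ('s, 'c, 'r) contract \<Rightarrow> bool" where
  "waste_blocks M \<mu> = (\<lambda>(s, c, r).
     (s, c, r) \<in> contracts M - \<mu> \<and> sprefers M s (Some (c, r)) (assigned \<mu> s) \<and>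
     feasible M ((\<mu> - contract_of \<mu> s) \<union> {(s, c, r)}))"

definition dominated :: "('s, 'c, 'r) market \<Rightarrow> ('s, 'c, 'r) contract set \<Rightarrow>
    ('s, 'c, 'r) contract \<Rightarrow> bool" where
  "dominated M \<mu> = (\<lambda>(s, c, r).
     \<exists>s' r'. (s', c, r') \<in> contracts M - \<mu> \<and>
       \<not> waste_blocks M \<mu> (s', c, r') \<and> \<not> direct_envy_blocks M \<mu> (s', c, r') \<and>
       direct_envy_blocks M ((\<mu> - contract_of \<mu> s) \<union> {(s, c, r)}) (s', c, r'))"

definition direct_envy_stable :: "('s, 'c, 'r) market \<Rightarrow> ('s, 'c, 'r) contract set \<Rightarrow> bool" where
  "direct_envy_stable M \<mu> \<longleftrightarrow> feasible M \<mu> \<and> individually_rational M \<mu> \<and>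
     (\<nexists>x. direct_envy_blocks M \<mu> x) \<and>
     (\<forall>x. waste_blocks M \<mu> x \<longrightarrow> dominated M \<mu> x)"

end

theory Submission
  imports Defs
begin

text \<open>Two students and two colleges \<open>0, 1\<close> and two resources \<open>1, 2\<close>, with all quotas and caps one.
  Student \<open>s\<close> ranks \<open>(1 - s, 1)\<close> over \<open>(s, 2)\<close> and accepts nothing else; college \<open>c\<close> prefers
  student \<open>c\<close>. Any two acceptable contracts of different students exclude each other and differ
  in the college or in the resource. By the latter a direct-envy-blocking contract never exists,
  so nothing is dominated and stability means non-wastefulness. By the former a feasible
  individually rational matching has at most one contract: if it is \<open>(s, 1 - s, 1)\<close>,
  then \<open>(1 - s, 1 - s, 2)\<close> envy-blocks through it, using the other resource; otherwise a student is free to move to its first choice.\<close>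

text \<open>Encodes a ranking by listing its alternatives from best to worst, so that concrete
  preferences can be decided by simplification.\<close>

primrec list_ranking :: "'a list \<Rightarrow> 'a rel" where
  "list_ranking [] = {}"
| "list_ranking (x # xs) = {x} \<times> set xs \<union> list_ranking xs"

lemma list_ranking_subset: "list_ranking xs \<subseteq> set xs \<times> set xs"
  by (induction xs) auto

lemma strict_ranking_list_ranking:
  assumes "distinct xs"
  shows "strict_ranking (set xs) (list_ranking xs)"
proof -
  have "strict_linear_order_on (set xs) (list_ranking xs)"
    using assms
  proof (induction xs)
    case Nil
    then show ?case
      by (simp add: strict_linear_order_on_def irrefl_def)
  next
    case (Cons x xs)
    note sub = list_ranking_subset[of xs]
    from Cons have IH: "trans (list_ranking xs)" "irrefl (list_ranking xs)"
      "total_on (set xs) (list_ranking xs)" and x: "x \<notin> set xs"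
      by (auto simp: strict_linear_order_on_def)
    have "trans (list_ranking (x # xs))"
      using IH(1) x sub unfolding trans_def by fastforce
    moreover have "irrefl (list_ranking (x # xs))"
      using IH(2) x unfolding irrefl_def by auto
    moreover have "total_on (set (x # xs)) (list_ranking (x # xs))"
      using IH(3) unfolding total_on_def by auto
    ultimately show ?case
      by (simp add: strict_linear_order_on_def)
  qed
  then show ?thesis
    by (simp add: strict_ranking_def list_ranking_subset)
qed

text \<open>On \<open>{0, 1}\<close> the map \<open>1 - _\<close> is the swap. The cap 2 of the
  empty resource \<open>0\<close> is the number of students, as the convention demands. Pairs with
  resource \<open>0\<close> are ranked last, hence below every acceptable pair.\<close>

definition crossed_market :: "(nat, nat, nat) market" where
  "crossed_market =
     \<lparr>students = {0, 1}, colleges = {0, 1}, resources = {1, 2}, empty_res = 0,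
      quota = (\<lambda>_. 1), region = (\<lambda>_. {0, 1}), cap = (\<lambda>r. if r = 0 then 2 else 1),
      col_pref = (\<lambda>c. list_ranking [c, 1 - c]),
      stud_pref = (\<lambda>s. list_ranking
        [Some (1 - s, 1), Some (s, 2), None,
         Some (s, 1), Some (1 - s, 2), Some (0, 0), Some (1, 0)])\<rparr>"

lemma valid_crossed_market: "valid_market crossed_market"
proof -
  have col: "strict_ranking {0, 1} (list_ranking [c, 1 - c])" if "c \<in> {0, 1}" for c :: nat
    using that strict_ranking_list_ranking[of "[c, 1 - c]"] by (auto simp: insert_commute)
  have stud: "strict_ranking (insert None (Some ` ({0, 1} \<times> {0, 1, 2})))
      (list_ranking [Some (1 - s, 1), Some (s, 2), None,
         Some (s, 1), Some (1 - s, 2), Some (0, 0), Some (1, 0 :: nat)])"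
    if "s \<in> {0, 1}" for s :: nat
  proof -
    let ?xs = "[Some (1 - s, 1), Some (s, 2), None,
         Some (s, 1), Some (1 - s, 2), Some (0, 0), Some (1, 0 :: nat)]"
    have "distinct ?xs" "set ?xs = insert None (Some ` ({0, 1} \<times> {0, 1, 2}))"
      using that by auto
    then show ?thesis
      using strict_ranking_list_ranking[of ?xs] by (simp only:)
  qed
  show ?thesis
    unfolding valid_market_def
  proof (intro conjI)
    show "\<forall>c\<in>colleges crossed_market.
        strict_ranking (students crossed_market) (col_pref crossed_market c)"
      using col unfolding crossed_market_def market.simps by blast
    show "\<forall>s\<in>students crossed_market. strict_ranking
        (insert None (Some ` (colleges crossed_market \<times> resources0 crossed_market)))
        (stud_pref crossed_market s)"
      using stud unfolding crossed_market_def resources0_def market.simps by blast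
  qed (auto simp: crossed_market_def acceptable_def sprefers_def)
qed

lemma sprefers_None_crossed_market:
  assumes "s \<in> {0, 1}"
  shows "sprefers crossed_market s (Some x) None \<longleftrightarrow> x = (1 - s, 1) \<or> x = (s, 2)"
  using assms by (auto simp: sprefers_def crossed_market_def)

lemma sprefers_first_choice_crossed_market:
  "sprefers crossed_market s (Some (1 - s, 1)) (Some (s, 2))"
  by (simp add: sprefers_def crossed_market_def)

lemma cprefers_crossed_market: "cprefers crossed_market c s s' \<longleftrightarrow> s = c \<and> s' = 1 - c"
  by (auto simp: cprefers_def crossed_market_def)

lemma assigned_empty: "assigned {} s = None"
  by (simp add: assigned_def)

lemma assigned_singleton: "assigned {(s, x)} t = (if t = s then Some x else None)"
  by (simp add: assigned_def)

lemma crossed_market_contract: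
  assumes "s \<in> {0, 1}" "c \<in> {0, 1}" "r \<in> {0, 1, 2}"
  shows "(s, c, r) \<in> contracts crossed_market"
  using assms by (auto simp: contracts_def resources0_def crossed_market_def)

lemma feasible_singleton_crossed_market:
  assumes "s \<in> {0, 1}" "c \<in> {0, 1}" "r \<in> {0, 1, 2}"
  shows "feasible crossed_market {(s, c, r)}"
proof -
  have card: "card A \<le> 1" if "A \<subseteq> {x}" for A and x :: "nat \<times> nat \<times> nat"
    using card_mono[OF _ that] by simp
  have "card {(s', c', r') \<in> {(s, c, r)}. c' = d} \<le> 1"
    "card {(s', c', r') \<in> {(s, c, r)}. r' = d} \<le> 1" for d
    by (rule card[of _ "(s, c, r)"], blast)+
  then show ?thesis
    using assms crossed_market_contract[OF assms]
    unfolding feasible_def matching_def by (simp add: crossed_market_def)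
qed

text \<open>Unit quotas and caps turn any shared entry into a conflict. Resource \<open>0\<close> is
  excepted because feasibility bounds only non-empty resources.\<close>

lemma feasible_crossed_market_unique:
  assumes "feasible crossed_market \<mu>" and "(s, c, r) \<in> \<mu>" "(s', c', r') \<in> \<mu>"
    and "s = s' \<or> c = c' \<or> r = r' \<and> r \<noteq> 0"
  shows "(s, c, r) = (s', c', r')"
proof -
  have sub: "\<mu> \<subseteq> contracts crossed_market"
    using assms(1) by (simp add: feasible_def matching_def)
  have "finite (contracts crossed_market)"
    by (simp add: contracts_def resources0_def crossed_market_def)
  with sub have fin: "finite \<mu>"
    by (rule finite_subset)
  have mem: "c \<in> {0, 1}" "r \<in> {0, 1, 2}"
    using assms(2) sub by (auto simp: contracts_def resources0_def crossed_market_def)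
  \<comment> \<open>Finiteness matters here: an infinite set has \<open>card\<close> 0 and would
    also meet the bound.\<close>
  have uniq: "x = y" if "card (\<mu> \<inter> A) \<le> 1" "x \<in> \<mu> \<inter> A" "y \<in> \<mu> \<inter> A" for A x y
    using that fin card_le_Suc0_iff_eq[of "\<mu> \<inter> A"] by auto
  have eq: "{(s, c', r) \<in> \<mu>. c' = c} = \<mu> \<inter> {(s, c', r). c' = c}"
    "{(s, c, r') \<in> \<mu>. r' = r} = \<mu> \<inter> {(s, c, r'). r' = r}"
    by auto
  have "card (\<mu> \<inter> {(s, c', r). c' = c}) \<le> 1"
    using assms(1) mem eq(1) unfolding feasible_def by (auto simp: crossed_market_def)
  moreover have "card (\<mu> \<inter> {(s, c, r'). r' = r}) \<le> 1" if "r \<noteq> 0"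
    using assms(1) mem eq(2) that unfolding feasible_def by (auto simp: crossed_market_def)
  moreover have "(c, r) = (c', r')" if "s = s'"
    using assms(1-3) that unfolding feasible_def matching_def by blast
  ultimately show ?thesis
    using assms(2-4) uniq by blast
qed

text \<open>The inclusion in the second case lets the empty matching be treated together with a lone
  second-choice contract.\<close>

lemma crossed_market_matching_cases:
  assumes "feasible crossed_market \<mu>" "individually_rational crossed_market \<mu>"
  obtains s where "s \<in> {0, 1}" "\<mu> = {(s, 1 - s, 1)}"
  | s where "s \<in> {0, 1}" "\<mu> \<subseteq> {(s, s, 2)}"
proof -
  have "x = (1 - s, 1) \<or> x = (s, 2)" "s \<in> {0, 1}" if "(s, x) \<in> \<mu>" for s x
  proof -
    show s: "s \<in> {0, 1}"
      using assms(1) that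
      by (auto simp: feasible_def matching_def contracts_def crossed_market_def)
    show "x = (1 - s, 1) \<or> x = (s, 2)"
      using assms(2) that sprefers_None_crossed_market[OF s, of x]
      by (auto simp: individually_rational_def acceptable_def)
  qed
  then have sub: "\<mu> \<subseteq> {(0, 1, 1), (0, 0, 2), (1, 0, 1), (1, 1, 2)}"
    by fastforce
  have excl: "x = y" if "x \<in> \<mu>" "y \<in> \<mu>" for x y
  proof -
    obtain s c r s' c' r' where xy: "x = (s, c, r)" "y = (s', c', r')"
      by (metis prod_cases3)
    \<comment> \<open>Checked over all pairs from the four acceptable contracts in
      \<open>sub\<close>.\<close>
    have "s = s' \<or> c = c' \<or> r = r' \<and> r \<noteq> 0"
      using that sub xy by auto
    with that show ?thesis
      using feasible_crossed_market_unique[OF assms(1)] xy by blast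
  qed
  show ?thesis
  proof (cases "\<mu> = {}")
    case True
    then show ?thesis
      using that(2)[of 0] by simp
  next
    case False
    then obtain x where "\<mu> = {x}"
      using excl by blast
    then show ?thesis
      using sub that(1)[of 0] that(1)[of 1] that(2)[of 0] that(2)[of 1] by auto
  qed
qed

text \<open>The other student is unmatched, is the favourite of the occupied college and accepts it
  with resource 2. Replacing the contract again leaves a singleton, which is feasible.\<close>

lemma first_choice_not_envy_free:
  assumes "s \<in> {0, 1}"
  shows "\<not> envy_free crossed_market {(s, 1 - s, 1)}"
proof -
  define t where "t = 1 - s"
  have t: "t \<in> {0, 1}" "s \<noteq> t" "s = 1 - t"
    using assms by (auto simp: t_def)
  have "envy_blocks_through crossed_market {(s, t, 1)} (t, t, 2) (s, t, 1)"
    using t crossed_market_contract[of t t 2] feasible_singleton_crossed_market[of t t 2]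
    by (auto simp: envy_blocks_through_def contract_of_def assigned_singleton
        sprefers_None_crossed_market cprefers_crossed_market)
  then show ?thesis
    by (auto simp: envy_free_def envy_blocks_def t_def)
qed

text \<open>Only the favourite \<open>1 - s\<close> of this college can envy there. Directness
  restricts \<open>r\<close> to the held resource 1 or the empty resource 0, but that student
  accepts its own college only with resource 2.\<close>

lemma no_direct_envy_at_first_choice:
  assumes "s \<in> {0, 1}"
  shows "\<not> direct_envy_blocks crossed_market {(s, 1 - s, 1)} (t, 1 - s, r)"
proof
  assume "direct_envy_blocks crossed_market {(s, 1 - s, 1)} (t, 1 - s, r)"
  then have blocks: "envy_blocks_through crossed_market {(s, 1 - s, 1)} (t, 1 - s, r) (s, 1 - s, 1)"
    and r: "r \<in> {0, 1}"
    by (auto simp: direct_envy_blocks_def crossed_market_def)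
  then have "t = 1 - s"
    by (simp add: envy_blocks_through_def cprefers_crossed_market)
  with blocks assms have "sprefers crossed_market t (Some (t, r)) None"
    by (auto simp: envy_blocks_through_def assigned_singleton)
  with \<open>t = 1 - s\<close> assms r show False
    by (auto simp: sprefers_None_crossed_market)
qed

text \<open>Moving \<open>s\<close> to its first choice is a waste-block. Domination would require
  direct envy at college \<open>1 - s\<close> after the move, where there is none.\<close>

lemma second_choice_not_direct_envy_stable:
  assumes "s \<in> {0, 1}" "\<mu> \<subseteq> {(s, s, 2)}"
  shows "\<not> direct_envy_stable crossed_market \<mu>"
proof -
  \<comment> \<open>Whether \<open>s\<close> is matched or not, the move leads to the same
    singleton.\<close>
  have upd: "(\<mu> - contract_of \<mu> s) \<union> {(s, 1 - s, 1)} = {(s, 1 - s, 1)}"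
    using assms(2) by (auto simp: contract_of_def)
  have "\<mu> = {} \<or> \<mu> = {(s, s, 2)}"
    using assms(2) by blast
  then have "sprefers crossed_market s (Some (1 - s, 1)) (assigned \<mu> s)"
    using assms(1) sprefers_first_choice_crossed_market[of s]
    by (auto simp: assigned_empty assigned_singleton sprefers_None_crossed_market)
  moreover have "(s, 1 - s, 1) \<in> contracts crossed_market - \<mu>"
    using assms crossed_market_contract[of s "1 - s" 1] by auto
  moreover have "feasible crossed_market {(s, 1 - s, 1)}"
    using assms(1) by (intro feasible_singleton_crossed_market) auto
  ultimately have "waste_blocks crossed_market \<mu> (s, 1 - s, 1)"
    unfolding waste_blocks_def prod.case upd by blast
  moreover have "\<not> dominated crossed_market \<mu> (s, 1 - s, 1)"
    unfolding dominated_def prod.case upd using no_direct_envy_at_first_choice[OF assms(1)] by blast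
  ultimately show ?thesis
    by (auto simp: direct_envy_stable_def)
qed

theorem proposition4:
  shows "\<exists>M :: (nat, nat, nat) market. valid_market M \<and>
    \<not> (\<exists>\<mu>. matching M \<mu> \<and> direct_envy_stable M \<mu> \<and> envy_free M \<mu>)"
proof (intro exI[of _ crossed_market] conjI notI)
  show "valid_market crossed_market"
    by (rule valid_crossed_market)
next
  assume "\<exists>\<mu>. matching crossed_market \<mu> \<and> direct_envy_stable crossed_market \<mu> \<and>
    envy_free crossed_market \<mu>"
  then obtain \<mu> where stable: "direct_envy_stable crossed_market \<mu>"
    and free: "envy_free crossed_market \<mu>"
    by blast
  from free have "feasible crossed_market \<mu>" "individually_rational crossed_market \<mu>"
    by (simp_all add: envy_free_def)
  then show False
  proof (cases rule: crossed_market_matching_cases)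
    case (1 s)
    then show ?thesis
      using free first_choice_not_envy_free by blast
  next
    case (2 s)
    then show ?thesis
      using stable second_choice_not_direct_envy_stable by blast
  qed
qed

end
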